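(* Algorithm 2 (described in the context) correctly solves the following problem: given a Run-Constrained Sentence Instance $(\Sigma,\Pi,(k_1,\ldots,k_m),D,G)$, find a valid pair $(t,w)$, or return null if none exists. That is, if a valid pair $(t,w)$ exists for the instance, then Algorithm 2 returns a valid pair; if no valid pair exists, then Algorithm 2 returns null.
   Context: A Run-Constrained Sentence Instance consists of: a finite alphabet $\Sigma$ with a partition function $\Pi:\Sigma\to\{A,B\}$, dividing $\Sigma$ into two classes, also denoted $A=\Pi^{-1}(A)$ and $B=\Pi^{-1}(B)$; a length pattern $(k_1,\ldots,k_m)$ of positive integers; a finite dictionary $D\subseteq\Sigma^*$ of words; and a context-free grammar $G=(V,D,P,S)$ over $D$ (finite set $V$ of nonterminals, terminals the words of $D$ treated as atomic symbols, finite set $P$ of productions $X\to\alpha$ with $X\in V$, $\alpha\in(V\cup D)^*$, start symbol $S\in V$), with language $L(G)\subseteq D^*$ the set of word sequences derivable from $S$. Alternating sequence: $t=((C_1,k_1),\ldots,(C_m,k_m))$ where each $C_i$ is a multi-set of symbols of $\Sigma$ with cardinality (with multiplicity) $|C_i|=k_i$ and, writing $\Sigma_{C_i}=\{C_i\}$ for its set of distinct symbols, either ($\Sigma_{C_i}\subseteq A$ for all odd $i$ and $\Sigma_{C_i}\subseteq B$ for all even $i$) or ($\Sigma_{C_i}\subseteq B$ for all odd $i$ and $\Sigma_{C_i}\subseteq A$ for all even $i$). Block language: $L_t=(\Sigma_{C_1})^{k_1}\cdots(\Sigma_{C_m})^{k_m}\subseteq\Sigma^K$, $K=\sum_i k_i$.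 Spelling homomorphism: $h:D^*\to\Sigma^*$ maps a sequence of words to the concatenation of their letters. A valid pair is a pair $(t,w)$ with $t$ an alternating sequence, $w\in L(G)$ and $h(w)\in L_t$. Letter-level automaton $M_t$: states $Q=\{q_0,\ldots,q_K\}$, start $q_0$, accepting set $F=\{q_K\}$; for $0\le j<K$ and $\sigma\in\Sigma$, $\delta_t(q_j,\sigma)=q_{j+1}$ if $\sigma\in\Sigma_{C_i}$, where $i$ is the index with $\sum_{\ell<i}k_\ell<j+1\le\sum_{\ell\le i}k_\ell$, and "reject" otherwise; $\delta_t(q_K,\sigma)=$ "reject" for all $\sigma$. Algorithm 1, on input $(t,D,G)$: construct $M_t$; construct the word-level automaton $\mathcal W=(Q,D,E)$, where for each $u\in D$ and $q\in Q$ the edge $(q,u,q')$ is added to $E$ when reading the letters of $u$ from $q$ in $M_t$ reaches $q'$ without rejection; apply a context-free parsing algorithm (e.g. CKY) on $\mathcal W$ to look for a path from $q_0$ to a state of $F$ whose sequence of word labels lies in $L(G)$; return that sequence of labels if such a path exists, and null otherwise. Algorithm 2, on input an instance: for each of the two alternation patterns $\alpha=(\alpha_1,\ldots,\alpha_m)\in\{(A,B,A,\ldots),(B,A,B,\ldots)\}$, and for each choice of multi-sets $(C_1,\ldots,C_m)$ with $|C_i|=k_i$ and $\{C_i\}\subseteq\alpha_i$, form $t=((C_1,k_1),\ldots,(C_m,k_m))$ and run Algorithm 1 on $(t,D,G)$; if its output $w$ is not null, return $(t,w)$ and stop. If all choices are exhausted, return null. *)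

theory Defs
  imports "HOL-Library.Multiset"
begin

section \<open>Context-free grammars over atomic terminals\<close>

datatype ('v, 'w) symb = NT 'v | Tm 'w

record ('v, 'w) cfg =
  nonterminals :: "'v set"
  terminals :: "'w set"
  productions :: "('v \<times> ('v, 'w) symb list) set"
  start_symb :: 'v

definition wf_cfg :: "('v, 'w) cfg \<Rightarrow> bool" where
  "wf_cfg G \<longleftrightarrow>
     finite (nonterminals G) \<and> finite (terminals G) \<and> finite (productions G) \<and>
     start_symb G \<in> nonterminals G \<and>
     (\<forall>(X, \<alpha>) \<in> productions G.
        X \<in> nonterminals G \<and> set \<alpha> \<subseteq> NT ` nonterminals G \<union> Tm ` terminals G)"

definition derives1 :: "('v, 'w) cfg \<Rightarrow> ('v, 'w) symb list \<Rightarrow> ('v, 'w) symb list \<Rightarrow> bool" where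
  "derives1 G x y \<longleftrightarrow>
     (\<exists>l r X \<alpha>. (X, \<alpha>) \<in> productions G \<and> x = l @ [NT X] @ r \<and> y = l @ \<alpha> @ r)"

definition cfg_lang :: "('v, 'w) cfg \<Rightarrow> 'w list set" where
  "cfg_lang G = {ws. (derives1 G)\<^sup>*\<^sup>* [NT (start_symb G)] (map Tm ws)}"


section \<open>Run-constrained sentence instances and valid pairs\<close>

datatype side = ClsA | ClsB

text \<open>Only the values of the partition function on the alphabet matter.\<close>

record ('a, 'v) rcs =
  alphabet :: "'a set"
  part :: "'a \<Rightarrow> side"
  lens :: "nat list"
  dict :: "'a list set"
  gram :: "('v, 'a list) cfg"

definition rcs_wf :: "('a, 'v) rcs \<Rightarrow> bool" where
  "rcs_wf I \<longleftrightarrow>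
     finite (alphabet I) \<and> (\<forall>k \<in> set (lens I). 0 < k) \<and>
     finite (dict I) \<and> dict I \<subseteq> lists (alphabet I) \<and>
     wf_cfg (gram I) \<and> terminals (gram I) = dict I"

definition letters :: "('a, 'v) rcs \<Rightarrow> side \<Rightarrow> 'a set" where
  "letters I c = {\<sigma> \<in> alphabet I. part I \<sigma> = c}"

type_synonym 'a blocks = "('a multiset \<times> nat) list"

text \<open>Blocks are indexed from 0 here, so the odd (even) positions of the usual
  1-based numbering are the even (odd) list indices.\<close>

definition alternating :: "('a, 'v) rcs \<Rightarrow> 'a blocks \<Rightarrow> bool" where
  "alternating I t \<longleftrightarrow>
     map snd t = lens I \<and>
     (\<forall>i < length t. size (fst (t ! i)) = snd (t ! i)) \<and>
     ((\<forall>i < length t. set_mset (fst (t ! i)) \<subseteq>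
         (if even i then letters I ClsA else letters I ClsB)) \<or>
      (\<forall>i < length t. set_mset (fst (t ! i)) \<subseteq>
         (if even i then letters I ClsB else letters I ClsA)))"

fun block_lang :: "'a blocks \<Rightarrow> 'a list set" where
  "block_lang [] = {[]}"
| "block_lang ((C, k) # t) =
     {u @ v | u v. u \<in> lists (set_mset C) \<and> length u = k \<and> v \<in> block_lang t}"

text \<open>The spelling homomorphism is \<^const>\<open>concat\<close>.\<close>

definition valid_pair :: "('a, 'v) rcs \<Rightarrow> 'a blocks \<times> 'a list list \<Rightarrow> bool" where
  "valid_pair I = (\<lambda>(t, w). alternating I t \<and> w \<in> cfg_lang (gram I) \<and> concat w \<in> block_lang t)"


section \<open>Letter-level and word-level automata\<close>

record ('q, 'a) letter_aut =
  la_states :: "'q set"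
  la_start :: 'q
  la_final :: "'q set"
  la_step :: "'q \<Rightarrow> 'a \<Rightarrow> 'q option"  \<comment> \<open>\<^const>\<open>None\<close> is ``reject''\<close>

definition total_len :: "'a blocks \<Rightarrow> nat" where
  "total_len t = sum_list (map snd t)"

definition block_index :: "'a blocks \<Rightarrow> nat \<Rightarrow> nat" where
  "block_index t j =
     (THE i. i < length t \<and> total_len (take i t) < j + 1 \<and> j + 1 \<le> total_len (take (Suc i) t))"

definition letter_automaton :: "'a blocks \<Rightarrow> (nat, 'a) letter_aut" where
  "letter_automaton t =
     \<lparr> la_states = {0..total_len t},
       la_start = 0,
       la_final = {total_len t},
       la_step = (\<lambda>j \<sigma>. if j < total_len t \<and> \<sigma> \<in> set_mset (fst (t ! block_index t j))
                        then Some (j + 1) else None) \<rparr>"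

fun read_letters :: "('q, 'a) letter_aut \<Rightarrow> 'q \<Rightarrow> 'a list \<Rightarrow> 'q option" where
  "read_letters M q [] = Some q"
| "read_letters M q (\<sigma> # u) =
     (case la_step M q \<sigma> of None \<Rightarrow> None | Some q' \<Rightarrow> read_letters M q' u)"

record ('q, 'w) word_aut =
  wa_states :: "'q set"
  wa_labels :: "'w set"
  wa_edges :: "('q \<times> 'w \<times> 'q) set"

definition word_automaton :: "('q, 'a) letter_aut \<Rightarrow> 'a list set \<Rightarrow> ('q, 'a list) word_aut" where
  "word_automaton M D =
     \<lparr> wa_states = la_states M,
       wa_labels = D,
       wa_edges = {(q, u, q'). q \<in> la_states M \<and> u \<in> D \<and> read_letters M q u = Some q'} \<rparr>"

fun label_path :: "('q, 'w) word_aut \<Rightarrow> 'q \<Rightarrow> 'w list \<Rightarrow> 'q \<Rightarrow> bool" where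
  "label_path W q [] q' \<longleftrightarrow> q \<in> wa_states W \<and> q = q'"
| "label_path W q (u # ws) q' \<longleftrightarrow> (\<exists>r. (q, u, r) \<in> wa_edges W \<and> label_path W r ws q')"


section \<open>The algorithms\<close>

text \<open>A context-free parsing algorithm on finite automata is used as a black box:
  given a finite automaton, a start state, a set of accepting states and a grammar, it returns the
  label sequence of some path from the start state to an accepting state that lies in the language
  of the grammar, if there is one, and \<^const>\<open>None\<close> otherwise. Which such sequence is
  returned is left open, as is the behaviour on ill-formed input.\<close>

type_synonym ('q, 'v, 'w) parser =
  "('q, 'w) word_aut \<Rightarrow> 'q \<Rightarrow> 'q set \<Rightarrow> ('v, 'w) cfg \<Rightarrow> 'w list option"

definition wf_parser_input :: "('q, 'w) word_aut \<Rightarrow> 'q \<Rightarrow> 'q set \<Rightarrow> ('v, 'w) cfg \<Rightarrow> bool" where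
  "wf_parser_input W s F G \<longleftrightarrow>
     finite (wa_states W) \<and> finite (wa_labels W) \<and>
     wa_edges W \<subseteq> wa_states W \<times> wa_labels W \<times> wa_states W \<and>
     s \<in> wa_states W \<and> F \<subseteq> wa_states W \<and>
     wf_cfg G \<and> terminals G = wa_labels W"

definition accepted_sentences :: "('q, 'w) word_aut \<Rightarrow> 'q \<Rightarrow> 'q set \<Rightarrow> ('v, 'w) cfg \<Rightarrow> 'w list set" where
  "accepted_sentences W s F G = {ws. (\<exists>f \<in> F. label_path W s ws f) \<and> ws \<in> cfg_lang G}"

definition cf_parsing_algorithm :: "('q, 'v, 'w) parser \<Rightarrow> bool" where
  "cf_parsing_algorithm parse \<longleftrightarrow>
     (\<forall>W s F G. wf_parser_input W s F G \<longrightarrow>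
        (case parse W s F G of
           Some ws \<Rightarrow> ws \<in> accepted_sentences W s F G
         | None \<Rightarrow> accepted_sentences W s F G = {}))"

lemma cf_parsing_algorithm_exists: "\<exists>parse :: ('q, 'v, 'w) parser. cf_parsing_algorithm parse"
proof
  show "cf_parsing_algorithm (\<lambda>W s F (G :: ('v, 'w) cfg).
    if accepted_sentences W (s :: 'q) F G = {} then None
    else Some (SOME ws. ws \<in> accepted_sentences W s F G))"
    unfolding cf_parsing_algorithm_def by (auto simp: some_in_eq)
qed

definition algorithm1 ::
  "(nat, 'v, 'a list) parser \<Rightarrow> 'a blocks \<Rightarrow> 'a list set \<Rightarrow> ('v, 'a list) cfg \<Rightarrow> 'a list list option" where
  "algorithm1 parse t D G =
     (let M = letter_automaton t; W = word_automaton M D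
      in parse W (la_start M) (la_final M) G)"

fun other :: "side \<Rightarrow> side" where
  "other ClsA = ClsB"
| "other ClsB = ClsA"

definition alt_pattern :: "side \<Rightarrow> nat \<Rightarrow> side list" where
  "alt_pattern c m = map (\<lambda>i. if even i then c else other c) [0..<m]"

definition choices :: "('a, 'v) rcs \<Rightarrow> side list \<Rightarrow> 'a multiset list set" where
  "choices I \<alpha> =
     {Cs. length Cs = length (lens I) \<and>
          (\<forall>i < length Cs. size (Cs ! i) = lens I ! i \<and> set_mset (Cs ! i) \<subseteq> letters I (\<alpha> ! i))}"

text \<open>The order in which the choices for a pattern are tried is left open: it is given by a
  function from patterns to lists.\<close>

definition enumerates_choices :: "('a, 'v) rcs \<Rightarrow> (side list \<Rightarrow> 'a multiset list list) \<Rightarrow> bool" where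
  "enumerates_choices I enum \<longleftrightarrow>
     (\<forall>c. set (enum (alt_pattern c (length (lens I)))) = choices I (alt_pattern c (length (lens I))))"

lemma enumerates_choices_exists:
  assumes "rcs_wf I"
  shows "\<exists>enum. enumerates_choices I enum"
proof -
  have fin: "finite (choices I \<alpha>)" for \<alpha>
  proof -
    let ?U = "\<Union>k \<in> set (lens I). multisets_of_size (alphabet I) k"
    have "finite ?U"
      using assms by (auto simp: rcs_wf_def intro!: finite_multisets_of_size)
    then have "finite {Cs. set Cs \<subseteq> ?U \<and> length Cs = length (lens I)}"
      by (rule finite_lists_length_eq)
    moreover have "choices I \<alpha> \<subseteq> {Cs. set Cs \<subseteq> ?U \<and> length Cs = length (lens I)}"
      by (fastforce simp: choices_def multisets_of_size_def letters_def in_set_conv_nth)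
    ultimately show ?thesis by (rule rev_finite_subset)
  qed
  have "\<forall>\<alpha>. \<exists>xs. set xs = choices I \<alpha>"
    using finite_list[OF fin] by blast
  then obtain enum where "\<forall>\<alpha>. set (enum \<alpha>) = choices I \<alpha>" by metis
  then show ?thesis unfolding enumerates_choices_def by blast
qed

fun first_result :: "('x \<Rightarrow> 'r option) \<Rightarrow> 'x list \<Rightarrow> 'r option" where
  "first_result f [] = None"
| "first_result f (x # xs) = (case f x of None \<Rightarrow> first_result f xs | Some r \<Rightarrow> Some r)"

definition algorithm2 ::
  "(nat, 'v, 'a list) parser \<Rightarrow> (side list \<Rightarrow> 'a multiset list list) \<Rightarrow> ('a, 'v) rcs
     \<Rightarrow> ('a blocks \<times> 'a list list) option" where
  "algorithm2 parse enum I =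
     first_result
       (\<lambda>c. first_result
          (\<lambda>Cs. let t = zip Cs (lens I)
                in case algorithm1 parse t (dict I) (gram I) of
                     None \<Rightarrow> None
                   | Some w \<Rightarrow> Some (t, w))
          (enum (alt_pattern c (length (lens I)))))
       [ClsA, ClsB]"

end

theory Submission
  imports Defs
begin

text \<open>Both the block language and the letter-level automaton constrain the letter at each position
  independently: position \<open>j\<close> must carry a symbol of the block containing \<open>j\<close>. Unrolling an
  alternating sequence into the list of these constraints shows that the automaton accepts exactly
  the block language, so that Algorithm 1 decides the existence of a sentence for a fixed
  alternating sequence. Algorithm 2 exhausts the alternating sequences, which are finite in number.\<close>

section \<open>Sentences of a context-free grammar\<close>

lemma derives1_preserves_alphabet:
  assumes "wf_cfg G" "derives1 G x y" "set x \<subseteq> NT ` nonterminals G \<union> Tm ` terminals G"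
  shows "set y \<subseteq> NT ` nonterminals G \<union> Tm ` terminals G"
proof -
  obtain l r X \<alpha> where "(X, \<alpha>) \<in> productions G" "x = l @ [NT X] @ r" "y = l @ \<alpha> @ r"
    using assms(2) unfolding derives1_def by blast
  moreover from this(1) have "set \<alpha> \<subseteq> NT ` nonterminals G \<union> Tm ` terminals G"
    using assms(1) unfolding wf_cfg_def by blast
  ultimately show ?thesis using assms(3) by simp
qed

text \<open>Paths of the word-level automaton carry only dictionary words. By this inclusion that
  restriction excludes no sentence of the grammar. The induction passes through sentential forms,
  since intermediate strings still contain nonterminals.\<close>

lemma cfg_lang_subset_lists_terminals:
  assumes "wf_cfg G"
  shows "cfg_lang G \<subseteq> lists (terminals G)"
proof
  fix ws assume "ws \<in> cfg_lang G"
  then have "(derives1 G)\<^sup>*\<^sup>* [NT (start_symb G)] (map Tm ws)"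
    by (simp add: cfg_lang_def)
  then have "set (map Tm ws :: (_, _) symb list) \<subseteq> NT ` nonterminals G \<union> Tm ` terminals G"
  proof (induction rule: rtranclp_induct)
    case base
    then show ?case using assms by (simp add: wf_cfg_def)
  next
    case (step y z)
    then show ?case using derives1_preserves_alphabet[OF assms] by blast
  qed
  then show "ws \<in> lists (terminals G)" by auto
qed

section \<open>Block languages as positionwise constraints\<close>

definition position_sets :: "'a blocks \<Rightarrow> 'a set list" where
  "position_sets t = concat (map (\<lambda>(C, k). replicate k (set_mset C)) t)"

lemma position_sets_simps [simp]:
  "position_sets [] = []"
  "position_sets ((C, k) # t) = replicate k (set_mset C) @ position_sets t"
  by (simp_all add: position_sets_def)

lemma total_len_simps [simp]:
  "total_len [] = 0"
  "total_len (b # t) = snd b + total_len t"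
  "total_len (s @ t) = total_len s + total_len t"
  by (simp_all add: total_len_def)

lemma length_position_sets [simp]: "length (position_sets t) = total_len t"
  by (induction t) auto

lemma mem_block_lang_iff: "u \<in> block_lang t \<longleftrightarrow> list_all2 (\<in>) u (position_sets t)"
proof (induction t arbitrary: u)
  case Nil
  then show ?case by simp
next
  case (Cons b t)
  obtain C k where b: "b = (C, k)" by (cases b)
  have "list_all2 (\<in>) v (replicate k (set_mset C)) \<longleftrightarrow> v \<in> lists (set_mset C) \<and> length v = k" for v
    by (auto simp: list_all2_conv_all_nth all_set_conv_all_nth in_lists_conv_set)
  moreover have "list_all2 (\<in>) u (replicate k (set_mset C) @ position_sets t) \<longleftrightarrow>
      (\<exists>v w. u = v @ w \<and> list_all2 (\<in>) v (replicate k (set_mset C)) \<and>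
         list_all2 (\<in>) w (position_sets t))"
    \<comment> \<open>The length conditions that \<open>list_all2_append2\<close> attaches to the
      two pieces already follow from \<open>list_all2\<close>.\<close>
    unfolding list_all2_append2 by (metis list_all2_lengthD)
  ultimately show ?case by (simp add: b Cons.IH)
qed

section \<open>Locating the block of a position\<close>

lemma total_len_take_mono: "i \<le> j \<Longrightarrow> total_len (take i t) \<le> total_len (take j t)"
  by (metis le_add1 le_add_diff_inverse take_add total_len_simps(3))

text \<open>Discharges the uniqueness part of the description: of two distinct blocks, the earlier
  ends no later than the other begins, because prefix lengths are monotone, so no position lies in
  both.\<close>

lemma block_index_eqI:
  assumes "i < length t" "total_len (take i t) < j + 1" "j + 1 \<le> total_len (take (Suc i) t)"
  shows "block_index t j = i"
  unfolding block_index_def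
proof (rule the_equality)
  fix i' assume i': "i' < length t \<and> total_len (take i' t) < j + 1 \<and>
    j + 1 \<le> total_len (take (Suc i') t)"
  show "i' = i"
    using assms i' total_len_take_mono[of "Suc i" i' t] total_len_take_mono[of "Suc i'" i t]
    by (cases i i' rule: linorder_cases) auto
qed (use assms in simp)

text \<open>Supplies the existence part, by peeling off the first block and shifting the position by
  its length. The constraint at the position is tracked in the same induction, so that
  \<open>block_index\<close> and \<open>position_sets\<close> can be compared.\<close>

lemma block_containing_position:
  assumes "j < total_len t"
  shows "\<exists>i < length t. total_len (take i t) < j + 1 \<and> j + 1 \<le> total_len (take (Suc i) t) \<and>
           position_sets t ! j = set_mset (fst (t ! i))"
  using assms
proof (induction t arbitrary: j)
  case Nil
  then show ?case by simp
next
  case (Cons b t)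
  obtain C k where b: "b = (C, k)" by (cases b)
  show ?case
  proof (cases "j < k")
    case True
    then show ?thesis by (intro exI[of _ 0]) (simp add: b nth_append)
  next
    case False
    then have "j - k < total_len t" using Cons.prems b by simp
    from Cons.IH[OF this] obtain i where "i < length t" "total_len (take i t) < j - k + 1"
      "j - k + 1 \<le> total_len (take (Suc i) t)"
      "position_sets t ! (j - k) = set_mset (fst (t ! i))" by blast
    then show ?thesis using False by (intro exI[of _ "Suc i"]) (simp add: b nth_append, linarith)
  qed
qed

lemma set_block_index:
  assumes "j < total_len t"
  shows "set_mset (fst (t ! block_index t j)) = position_sets t ! j"
  using block_containing_position[OF assms] block_index_eqI by metis

section \<open>Runs of the letter-level automaton\<close>

lemma la_step_letter_automaton:
  "la_step (letter_automaton t) j \<sigma> =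
     (if j < total_len t \<and> \<sigma> \<in> position_sets t ! j then Some (j + 1) else None)"
  by (auto simp: letter_automaton_def set_block_index)

text \<open>State \<open>j\<close> means that \<open>j\<close> constraints have been consumed, so
  \<open>drop j\<close> is what remains for the rest of the input. The start state is arbitrary
  because each letter read advances it in the induction.\<close>

lemma read_letter_automaton:
  assumes "j \<le> total_len t"
  shows "read_letters (letter_automaton t) j u = Some (total_len t) \<longleftrightarrow>
           list_all2 (\<in>) u (drop j (position_sets t))"
  using assms
proof (induction u arbitrary: j)
  case Nil
  then show ?case by auto
next
  case (Cons \<sigma> u)
  show ?case
  proof (cases "j < total_len t")
    case True
    then have "drop j (position_sets t) = position_sets t ! j # drop (Suc j) (position_sets t)"
      by (simp add: Cons_nth_drop_Suc)
    with True Cons.IH[of "Suc j"] show ?thesis by (simp add: la_step_letter_automaton)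
  next
    \<comment> \<open>Here \<open>j\<close> is the final state: no constraint is left and every
      letter is rejected, so both sides fail on a nonempty input.\<close>
    case False
    then show ?thesis by (simp add: la_step_letter_automaton)
  qed
qed

lemma letter_automaton_accepts_iff:
  "read_letters (letter_automaton t) 0 u = Some (total_len t) \<longleftrightarrow> u \<in> block_lang t"
  by (simp add: read_letter_automaton mem_block_lang_iff)

section \<open>From letters to words\<close>

lemma read_letters_append:
  "read_letters M q (u @ v) = Option.bind (read_letters M q u) (\<lambda>r. read_letters M r v)"
  by (induction u arbitrary: q) (auto split: option.split)

lemma read_letters_in_states:
  assumes "\<And>q \<sigma> r. q \<in> la_states M \<Longrightarrow> la_step M q \<sigma> = Some r \<Longrightarrow> r \<in> la_states M"
    and "q \<in> la_states M" "read_letters M q u = Some r"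
  shows "r \<in> la_states M"
  using assms(2,3)
  by (induction u arbitrary: q) (auto split: option.splits intro: assms(1))

text \<open>An edge abbreviates the run over one word, so a path composes these runs into a single
  run over the spelling. Closure of the state set under steps keeps every intermediate state a legal
  source for the next edge.\<close>

lemma label_path_word_automaton_iff:
  assumes "\<And>q \<sigma> r. q \<in> la_states M \<Longrightarrow> la_step M q \<sigma> = Some r \<Longrightarrow> r \<in> la_states M"
    and "q \<in> la_states M"
  shows "label_path (word_automaton M D) q ws r \<longleftrightarrow>
           ws \<in> lists D \<and> read_letters M q (concat ws) = Some r"
  using assms(2)
proof (induction ws arbitrary: q)
  case Nil
  then show ?case by (simp add: word_automaton_def)
next
  case (Cons u ws)
  have "label_path (word_automaton M D) q (u # ws) r \<longleftrightarrow>
      u \<in> D \<and> (\<exists>p. read_letters M q u = Some p \<and> label_path (word_automaton M D) p ws r)"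
    using Cons.prems by (auto simp: word_automaton_def)
  also have "\<dots> \<longleftrightarrow> u # ws \<in> lists D \<and> read_letters M q (concat (u # ws)) = Some r"
    \<comment> \<open>The state reached after \<open>u\<close> lies in the state set, as the
      induction hypothesis requires.\<close>
    using Cons.IH read_letters_in_states[OF assms(1) Cons.prems]
    by (auto simp: read_letters_append bind_eq_Some_conv)
  finally show ?case .
qed

section \<open>Correctness of Algorithm 1\<close>

lemma letter_automaton_step_closed:
  assumes "la_step (letter_automaton t) q \<sigma> = Some r"
  shows "r \<in> la_states (letter_automaton t)"
  using assms by (auto simp: la_step_letter_automaton letter_automaton_def split: if_splits)

lemma accepted_sentences_word_automaton:
  fixes G :: "('v, 'a list) cfg"
  assumes "wf_cfg G" "terminals G = D"
  shows "accepted_sentences (word_automaton (letter_automaton t) D) 0 {total_len t} G =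
           {w \<in> cfg_lang G. concat w \<in> block_lang t}"
proof -
  have "label_path (word_automaton (letter_automaton t) D) 0 w (total_len t) \<longleftrightarrow>
      w \<in> lists D \<and> concat w \<in> block_lang t" for w
    by (subst label_path_word_automaton_iff)
      (auto simp: letter_automaton_accepts_iff intro: letter_automaton_step_closed,
       simp add: letter_automaton_def)
  then show ?thesis
    using cfg_lang_subset_lists_terminals[OF assms(1)] assms(2)
    by (auto simp: accepted_sentences_def)
qed

lemma algorithm1_correct:
  fixes G :: "('v, 'a list) cfg"
  assumes "cf_parsing_algorithm parse" "wf_cfg G" "finite D" "terminals G = D"
  shows "case algorithm1 parse t D G of
           Some w \<Rightarrow> w \<in> cfg_lang G \<and> concat w \<in> block_lang t
         | None \<Rightarrow> \<forall>w \<in> cfg_lang G. concat w \<notin> block_lang t"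
proof -
  let ?W = "word_automaton (letter_automaton t) D"
  \<comment> \<open>The parser's guarantee is conditional on well-formed input; the requirement
    needing an argument is that edges end inside the state set.\<close>
  have "r \<in> {0..total_len t}"
    if "q \<in> {0..total_len t}" "read_letters (letter_automaton t) q u = Some r" for q u r
    using that read_letters_in_states[OF letter_automaton_step_closed]
    by (simp add: letter_automaton_def)
  then have "wf_parser_input ?W 0 {total_len t} G"
    using assms by (auto simp: wf_parser_input_def word_automaton_def letter_automaton_def)
  then have "case parse ?W 0 {total_len t} G of
      Some w \<Rightarrow> w \<in> accepted_sentences ?W 0 {total_len t} G
    | None \<Rightarrow> accepted_sentences ?W 0 {total_len t} G = {}"
    using assms(1) by (simp add: cf_parsing_algorithm_def)
  moreover have "algorithm1 parse t D G = parse ?W 0 {total_len t} G"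
    by (simp add: algorithm1_def Let_def letter_automaton_def)
  ultimately show ?thesis
    by (auto simp: accepted_sentences_word_automaton[OF assms(2,4)] split: option.splits)
qed

section \<open>Exhaustive search in Algorithm 2\<close>

lemma first_result_eq_None_iff: "first_result f xs = None \<longleftrightarrow> (\<forall>x \<in> set xs. f x = None)"
  by (induction xs) (auto split: option.splits)

lemma first_result_eq_SomeD: "first_result f xs = Some r \<Longrightarrow> \<exists>x \<in> set xs. f x = Some r"
  by (induction xs) (auto split: option.splits)

text \<open>Identifies the search space of Algorithm 2 with the alternating sequences, which gives
  both soundness and completeness of the search.\<close>

lemma alternating_iff_choices:
  "alternating I t \<longleftrightarrow>
     (\<exists>c. \<exists>Cs \<in> choices I (alt_pattern c (length (lens I))). t = zip Cs (lens I))"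
proof -
  \<comment> \<open>\<open>c\<close> is the class prescribed for the first block; the two disjuncts
    in \<open>alternating\<close> are \<open>P ClsA\<close> and \<open>P ClsB\<close>.\<close>
  define P where "P c \<longleftrightarrow> (\<forall>i < length t. set_mset (fst (t ! i)) \<subseteq>
    letters I (if even i then c else other c))" for c
  have "alternating I t \<longleftrightarrow> map snd t = lens I \<and>
      (\<forall>i < length t. size (fst (t ! i)) = snd (t ! i)) \<and> (\<exists>c. P c)"
  proof -
    have "(\<exists>c. P c) \<longleftrightarrow> P ClsA \<or> P ClsB" by (metis side.exhaust)
    then show ?thesis by (simp add: alternating_def P_def if_distrib cong: if_cong)
  qed
  also have "\<dots> \<longleftrightarrow> (\<exists>c. map snd t = lens I \<and> map fst t \<in> choices I (alt_pattern c (length (lens I))))"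
  proof -
    have "map fst t \<in> choices I (alt_pattern c (length (lens I))) \<longleftrightarrow>
        (\<forall>i < length t. size (fst (t ! i)) = snd (t ! i)) \<and> P c" if "map snd t = lens I" for c
      \<comment> \<open>Rewriting \<open>lens I\<close> back to \<open>map snd t\<close> settles the
        length condition and turns \<open>lens I ! i\<close> into
        \<open>snd (t ! i)\<close>.\<close>
      by (auto simp: choices_def alt_pattern_def P_def simp flip: that)
    then show ?thesis by blast
  qed
  also have "\<dots> \<longleftrightarrow> (\<exists>c. \<exists>Cs \<in> choices I (alt_pattern c (length (lens I))). t = zip Cs (lens I))"
  proof -
    have "map snd t = lens I \<and> map fst t \<in> choices I \<alpha> \<longleftrightarrow>
        (\<exists>Cs \<in> choices I \<alpha>. t = zip Cs (lens I))" for \<alpha>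
    proof
      assume "map snd t = lens I \<and> map fst t \<in> choices I \<alpha>"
      then show "\<exists>Cs \<in> choices I \<alpha>. t = zip Cs (lens I)"
        by (metis zip_map_fst_snd)
    next
      assume "\<exists>Cs \<in> choices I \<alpha>. t = zip Cs (lens I)"
      then obtain Cs where "Cs \<in> choices I \<alpha>" "t = zip Cs (lens I)" by blast
      \<comment> \<open>With equal lengths \<open>zip\<close> truncates nothing, so both projections
        recover their lists.\<close>
      moreover from this have "length Cs = length (lens I)" by (simp add: choices_def)
      ultimately show "map snd t = lens I \<and> map fst t \<in> choices I \<alpha>" by simp
    qed
    then show ?thesis by blast
  qed
  finally show ?thesis .
qed

lemma algorithm2_eq_SomeD:
  assumes "enumerates_choices I enum" "algorithm2 parse enum I = Some (t, w)"
  shows "alternating I t \<and> algorithm1 parse t (dict I) (gram I) = Some w"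
  using assms
  \<comment> \<open>\<open>first_result\<close> stays folded so that
    \<open>first_result_eq_SomeD\<close> applies to the outer search over classes as well as to the
    inner one over choices.\<close>
  by (auto simp: algorithm2_def enumerates_choices_def alternating_iff_choices Let_def
      simp del: first_result.simps dest!: first_result_eq_SomeD split: option.splits) blast+

text \<open>Failure propagates inwards: a fruitless search means that every candidate failed, and
  \<open>t\<close> is a candidate for some class and choice.\<close>

lemma algorithm2_eq_NoneD:
  assumes "enumerates_choices I enum" "algorithm2 parse enum I = None" "alternating I t"
  shows "algorithm1 parse t (dict I) (gram I) = None"
proof -
  obtain c Cs where Cs: "Cs \<in> choices I (alt_pattern c (length (lens I)))" "t = zip Cs (lens I)"
    using assms(3) alternating_iff_choices by blast
  have "c \<in> set [ClsA, ClsB]" by (cases c) auto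
  then have "first_result
      (\<lambda>Cs. let t = zip Cs (lens I)
            in case algorithm1 parse t (dict I) (gram I) of None \<Rightarrow> None | Some w \<Rightarrow> Some (t, w))
      (enum (alt_pattern c (length (lens I)))) = None"
    using assms(2) unfolding algorithm2_def first_result_eq_None_iff by blast
  moreover have "Cs \<in> set (enum (alt_pattern c (length (lens I))))"
    using Cs(1) assms(1) by (simp add: enumerates_choices_def)
  ultimately have "(let t = zip Cs (lens I)
      in case algorithm1 parse t (dict I) (gram I) of None \<Rightarrow> None | Some w \<Rightarrow> Some (t, w)) = None"
    unfolding first_result_eq_None_iff by blast
  then show ?thesis by (simp add: Cs(2) Let_def split: option.splits)
qed

theorem theorem5p7:
  fixes I :: "('a, 'v) rcs"
    and parse :: "(nat, 'v, 'a list) parser"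
    and enum :: "side list \<Rightarrow> 'a multiset list list"
  assumes "rcs_wf I"
    and "cf_parsing_algorithm parse"
    and "enumerates_choices I enum"
  shows "((\<exists>t w. valid_pair I (t, w)) \<longrightarrow>
            (\<exists>t w. algorithm2 parse enum I = Some (t, w) \<and> valid_pair I (t, w))) \<and>
         ((\<nexists>t w. valid_pair I (t, w)) \<longrightarrow> algorithm2 parse enum I = None)"
proof -
  have alg1: "case algorithm1 parse t (dict I) (gram I) of
      Some w \<Rightarrow> w \<in> cfg_lang (gram I) \<and> concat w \<in> block_lang t
    | None \<Rightarrow> \<forall>w \<in> cfg_lang (gram I). concat w \<notin> block_lang t" for t
    using assms(1) by (intro algorithm1_correct[OF assms(2)]) (auto simp: rcs_wf_def)
  show ?thesis
  \<comment> \<open>Splitting on the output handles both implications: \<open>None\<close> excludes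
    every valid pair, and any returned pair is itself valid, so in each case one implication is
    vacuous.\<close>
  proof (cases "algorithm2 parse enum I")
    case None
    then have "\<not> valid_pair I (t, w)" for t w
      using algorithm2_eq_NoneD[OF assms(3) None, of t] alg1[of t] by (auto simp: valid_pair_def)
    with None show ?thesis by blast
  next
    case (Some p)
    obtain t w where p: "p = (t, w)" by (cases p)
    have "valid_pair I (t, w)"
      using algorithm2_eq_SomeD[OF assms(3) Some[unfolded p]] alg1[of t]
      by (auto simp: valid_pair_def)
    with Some p show ?thesis by blast
  qed
qed

end
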